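(* Let $B^{\bullet}=(B^{\bullet}(x,y):x,y\in\mathbb Z^2)$ be the tilt-indexed Busemann process on $(\Omega,\mathcal F,\mathbb P)$ and let $z\in\mathbb Z^2\setminus\{0\}$. Then $B^\bullet$ is strongly mixing under $T_z$. Explicitly, for all events $A\in\mathcal F$ and all measurable sets $C$ of the state space of $B^\bullet$, $$\lim_{n\to\infty}\mathbb P\bigl(A,\ B^\bullet\circ T_z^{-n}\in C\bigr)=\mathbb P(A)\,\mathbb P(B^\bullet\in C).$$
   Context: $\Omega=\mathbb R^{\mathbb Z^2}$ with its Borel $\sigma$-algebra $\mathcal F$, generic element $\omega=(\omega_x)_{x\in\mathbb Z^2}$, shifts $(T_z\omega)_x=\omega_{x+z}$. $\mathbb P$ is a product probability measure on $\Omega$ under which the $\omega_x$ are i.i.d. with $\mathbb E[|\omega_0|^{2+\epsilon}]<\infty$ for some $\epsilon>0$ and $\mathbb E[\omega_0^2]>\mathbb E[\omega_0]^2$. For $u\in\mathbb Z^2$, $\mathcal F_u^+$ is the $\sigma$-algebra generated by $\{\omega_y:y-u\in\mathbb Z_+^2\}$, $\mathbb Z_+=\{0,1,2,\dots\}$. $e_1=(1,0)$, $e_2=(0,1)$. A function $b:\mathbb Z^2\times\mathbb Z^2\to\mathbb R$ is a cocycle if $b(x,y)+b(y,z)=b(x,z)$ for all $x,y,z$; it recovers the weights $\omega$ if $\min\{b(x,x+e_1),b(x,x+e_2)\}=\omega_x$ for all $x$. $\mathcal K$ is the collection of measurable functions $B:\Omega\times\mathbb Z^2\times\mathbb Z^2\to\mathbb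 R$ such that: $\mathbb P$-a.s. $B(\omega,\cdot,\cdot)$ is a cocycle recovering $\omega$; $\mathbb P$-a.s. $B(\omega,x+z,y+z)=B(T_z\omega,x,y)$ for all $x,y,z$; and $\mathbb E[|B(x,y)|]<\infty$ for all $x,y$. For $B\in\mathcal K$, $\mathbf h(B)\in\mathbb R^2$ is the deterministic vector with $\mathbf h(B)\cdot e_i=-\mathbb E[B(0,e_i)]$. For $u\in\mathbb Z^2$ let $x^{B,u}(\omega)$ be the semi-infinite path started at $u$ which from each visited site $x$ steps to $x+e_1$ if $B(\omega,x,x+e_1)\le B(\omega,x,x+e_2)$ and to $x+e_2$ otherwise. Up-right paths are indexed by antidiagonal level, $\pi_i\cdot(e_1+e_2)=i$; two semi-infinite up-right paths coalesce if they agree at all sufficiently large levels. $\mathcal K_c\subset\mathcal K$ is the set of those $B$ for which, $\mathbb P$-a.s., $x^{B,u}$ and $x^{B,v}$ coalesce for all $u,v$. $\mathcal K_c^+$ is the set of $B\in\mathcal K_c$ that are forward measurable: for all $u$ and $x,y\in u+\mathbb Z_+^2$, $\omega\mapsto B(\omega,x,y)$ is $\mathcal F_u^+$-measurable. The set of tilts is $\mathcal H=\{\mathbf h(B):B\in\mathcal K_c\}\subset\mathbb R^2$. The tilt-indexed Busemann process is the ($\mathbb P$-almost surely unique) process $(B^{h\sigma}(x,y):x,y\in\mathbb Z^2,h\in\mathcal H,\sigma\in\{+,-\})$ on $(\Omega,\mathcal F,\mathbb P)$ such that: (a) for each $h\in\mathcal H$, $B^{h-}=B^{h+}$ a.s.,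 with common value denoted $B^h$; (b) $B^h\in\mathcal K_c^+$ for each $h$; (c) $\mathbb E[B^h(0,e_i)]=-h\cdot e_i$; (d) for $h\cdot e_1\le h'\cdot e_1$ and all $x$, a.s. $B^{h-}(x,x+e_1)\ge B^{h+}(x,x+e_1)\ge B^{h'-}(x,x+e_1)\ge B^{h'+}(x,x+e_1)$, with reversed inequalities for $e_2$-increments; (e) a.s., for all $h,x,y$, $B^{h-}(x,y)$ (resp. $B^{h+}(x,y)$) is the limit of $B^{h'\pm}(x,y)$ as $h'\to h$ in $\mathcal H$ with $h'\cdot e_1\nearrow h\cdot e_1$ (resp. $\searrow$), when $h$ is an accumulation point of $\mathcal H$ from that side. $B^\bullet(x,y)$ denotes the process in the index $(h,\sigma)\in\mathcal H\times\{+,-\}$; $B^\bullet\circ T_z^{-n}$ denotes $\omega\mapsto B^\bullet(T_z^{-n}\omega)$. The state space $\mathbb R^{\mathbb Z^2\times\mathbb Z^2\times\mathcal H\times\{+,-\}}$ carries the $\sigma$-algebra generated by the coordinate evaluations. *)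

theory Defs
  imports "HOL-Probability.Probability"
begin

type_synonym site = "int \<times> int"
type_synonym env = "site \<Rightarrow> real"
type_synonym tilt = "real \<times> real"

datatype side = Minus | Plus

definition e1 :: site where "e1 = (1, 0)"
definition e2 :: site where "e2 = (0, 1)"

definition env_shift :: "site \<Rightarrow> env \<Rightarrow> env" where
  "env_shift z \<omega> = (\<lambda>x. \<omega> (x + z))"

definition quadrant :: "site \<Rightarrow> site set" where
  "quadrant u = {y. fst (y - u) \<ge> 0 \<and> snd (y - u) \<ge> 0}"

definition forward_algebra :: "site \<Rightarrow> env measure" where
  "forward_algebra u =
     sigma UNIV {(\<lambda>\<omega>. \<omega> y) -` S | y S. y \<in> quadrant u \<and> S \<in> sets (borel :: real measure)}"

definition cocycle :: "(site \<Rightarrow> site \<Rightarrow> real) \<Rightarrow> bool" where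
  "cocycle b \<longleftrightarrow> (\<forall>x y z. b x y + b y z = b x z)"

definition recovers :: "(site \<Rightarrow> site \<Rightarrow> real) \<Rightarrow> env \<Rightarrow> bool" where
  "recovers b \<omega> \<longleftrightarrow> (\<forall>x. min (b x (x + e1)) (b x (x + e2)) = \<omega> x)"

definition jointly_measurable :: "env measure \<Rightarrow> (env \<Rightarrow> site \<Rightarrow> site \<Rightarrow> real) \<Rightarrow> bool" where
  "jointly_measurable P B \<longleftrightarrow>
     (\<lambda>(\<omega>, x, y). B \<omega> x y)
       \<in> borel_measurable (P \<Otimes>\<^sub>M (count_space UNIV \<Otimes>\<^sub>M count_space UNIV))"

definition K :: "env measure \<Rightarrow> (env \<Rightarrow> site \<Rightarrow> site \<Rightarrow> real) set" where
  "K P = {B. jointly_measurable P B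
     \<and> (AE \<omega> in P. cocycle (B \<omega>) \<and> recovers (B \<omega>) \<omega>)
     \<and> (AE \<omega> in P. \<forall>x y z. B \<omega> (x + z) (y + z) = B (env_shift z \<omega>) x y)
     \<and> (\<forall>x y. integrable P (\<lambda>\<omega>. B \<omega> x y))}"

definition tilt_of :: "env measure \<Rightarrow> (env \<Rightarrow> site \<Rightarrow> site \<Rightarrow> real) \<Rightarrow> tilt" where
  "tilt_of P B = (- (\<integral>\<omega>. B \<omega> 0 e1 \<partial>P), - (\<integral>\<omega>. B \<omega> 0 e2 \<partial>P))"

definition level :: "site \<Rightarrow> int" where
  "level x = fst x + snd x"

definition path_step :: "(site \<Rightarrow> site \<Rightarrow> real) \<Rightarrow> site \<Rightarrow> site" where
  "path_step b x = (if b x (x + e1) \<le> b x (x + e2) then x + e1 else x + e2)"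

(* Indexed by antidiagonal level; only levels i >= level u are meaningful. *)
definition busemann_path :: "(site \<Rightarrow> site \<Rightarrow> real) \<Rightarrow> site \<Rightarrow> int \<Rightarrow> site" where
  "busemann_path b u i = (path_step b ^^ nat (i - level u)) u"

definition coalesce :: "(int \<Rightarrow> site) \<Rightarrow> (int \<Rightarrow> site) \<Rightarrow> bool" where
  "coalesce p q \<longleftrightarrow> (\<exists>N. \<forall>i\<ge>N. p i = q i)"

definition Kc :: "env measure \<Rightarrow> (env \<Rightarrow> site \<Rightarrow> site \<Rightarrow> real) set" where
  "Kc P = {B \<in> K P. AE \<omega> in P. \<forall>u v. coalesce (busemann_path (B \<omega>) u) (busemann_path (B \<omega>) v)}"

definition Kc_plus :: "env measure \<Rightarrow> (env \<Rightarrow> site \<Rightarrow> site \<Rightarrow> real) set" where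
  "Kc_plus P = {B \<in> Kc P. \<forall>u. \<forall>x\<in>quadrant u. \<forall>y\<in>quadrant u.
     (\<lambda>\<omega>. B \<omega> x y) \<in> borel_measurable (forward_algebra u)}"

definition tilts :: "env measure \<Rightarrow> tilt set" where
  "tilts P = tilt_of P ` Kc P"

(* The common value of the two sides at a fixed tilt is only defined almost surely; it is
   represented by a version Bh, and the two sides need only agree with it almost surely.
   Values of B at tilts outside tilts P are irrelevant. *)
definition busemann_process ::
  "env measure \<Rightarrow> (tilt \<Rightarrow> side \<Rightarrow> env \<Rightarrow> site \<Rightarrow> site \<Rightarrow> real) \<Rightarrow> bool" where
  "busemann_process P B \<longleftrightarrow>
     (\<forall>h\<in>tilts P. \<forall>s. jointly_measurable P (B h s))
   \<and> (\<forall>h\<in>tilts P. \<exists>Bh\<in>Kc_plus P.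
        (AE \<omega> in P. \<forall>x y. B h Minus \<omega> x y = Bh \<omega> x y \<and> B h Plus \<omega> x y = Bh \<omega> x y)
        \<and> (\<integral>\<omega>. Bh \<omega> 0 e1 \<partial>P) = - fst h \<and> (\<integral>\<omega>. Bh \<omega> 0 e2 \<partial>P) = - snd h)
   \<and> (\<forall>h\<in>tilts P. \<forall>h'\<in>tilts P. fst h \<le> fst h' \<longrightarrow> (\<forall>x. AE \<omega> in P.
          B h Minus \<omega> x (x + e1) \<ge> B h Plus \<omega> x (x + e1)
        \<and> B h Plus \<omega> x (x + e1) \<ge> B h' Minus \<omega> x (x + e1)
        \<and> B h' Minus \<omega> x (x + e1) \<ge> B h' Plus \<omega> x (x + e1)
        \<and> B h Minus \<omega> x (x + e2) \<le> B h Plus \<omega> x (x + e2)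
        \<and> B h Plus \<omega> x (x + e2) \<le> B h' Minus \<omega> x (x + e2)
        \<and> B h' Minus \<omega> x (x + e2) \<le> B h' Plus \<omega> x (x + e2)))
   \<and> (AE \<omega> in P. \<forall>h\<in>tilts P. \<forall>x y.
          (h islimpt {h' \<in> tilts P. fst h' < fst h} \<longrightarrow>
             (\<forall>s. ((\<lambda>h'. B h' s \<omega> x y) \<longlongrightarrow> B h Minus \<omega> x y)
                (at h within {h' \<in> tilts P. fst h' < fst h})))
        \<and> (h islimpt {h' \<in> tilts P. fst h' > fst h} \<longrightarrow>
             (\<forall>s. ((\<lambda>h'. B h' s \<omega> x y) \<longlongrightarrow> B h Plus \<omega> x y)
                (at h within {h' \<in> tilts P. fst h' > fst h}))))"

definition state_index :: "env measure \<Rightarrow> (site \<times> site \<times> tilt \<times> side) set" where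
  "state_index P = UNIV \<times> UNIV \<times> tilts P \<times> UNIV"

definition state_space :: "env measure \<Rightarrow> (site \<times> site \<times> tilt \<times> side \<Rightarrow> real) measure" where
  "state_space P = (\<Pi>\<^sub>M i\<in>state_index P. borel)"

definition state_of ::
  "env measure \<Rightarrow> (tilt \<Rightarrow> side \<Rightarrow> env \<Rightarrow> site \<Rightarrow> site \<Rightarrow> real)
     \<Rightarrow> env \<Rightarrow> (site \<times> site \<times> tilt \<times> side \<Rightarrow> real)" where
  "state_of P B \<omega> = (\<lambda>(x, y, h, s)\<in>state_index P. B h s \<omega> x y)"

end

theory Submission
  imports Defs
begin

text \<open>
  Each coordinate of the Busemann process is a measurable function of the environment, so
  \<open>state_of P B\<close> is measurable and \<open>{\<omega>. state_of P B \<omega> \<in> C}\<close> is an event \<open>D\<close> of the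
  environment space. The claim is therefore an instance of the mixing of an i.i.d. field under
  a nonzero translation: the probability of \<open>A \<inter> (T\<^sub>z)\<^sup>n D\<close> converges to the product of the
  probabilities of \<open>A\<close> and \<open>D\<close>. When \<open>A\<close> and \<open>D\<close> are finite-dimensional cylinders, the two
  events depend on disjoint sets of sites for all large \<open>n\<close>, so they are eventually independent.
  The set of events for which the limit relation holds is a Dynkin system
  (\<open>tendsto_product_on_generator\<close>), and cylinders are stable under intersection, so the relation
  extends to all \<open>D\<close> and all \<open>A\<close>, one argument at a time (\<open>iid_field_mixing\<close>).
\<close>

text \<open>
  The Dynkin argument behind both extensions from cylinders to general events. It is used once
  with \<open>g n\<close> the \<open>n\<close>-th relabelling of the coordinates and \<open>E n\<close> constant, and once with \<open>g n\<close>
  the identity and \<open>E n\<close> the preimages of a fixed event under these relabellings.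
\<close>
lemma (in prob_space) tendsto_product_on_generator:
  fixes E :: "nat \<Rightarrow> 'a set" and g :: "nat \<Rightarrow> 'a \<Rightarrow> 'a"
  assumes E: "\<And>n. E n \<in> events" "\<And>n. prob (E n) = e"
    and g: "\<And>n. g n \<in> measurable M M" "\<And>n. distr M M (g n) = M"
    and gen: "Int_stable G" "G \<subseteq> Pow (space M)" "events = sigma_sets (space M) G"
    and lim: "\<And>X. X \<in> G \<Longrightarrow> (\<lambda>n. prob (E n \<inter> (g n -` X \<inter> space M))) \<longlonglongrightarrow> e * prob X"
    and X: "X \<in> events"
  shows "(\<lambda>n. prob (E n \<inter> (g n -` X \<inter> space M))) \<longlonglongrightarrow> e * prob X"
proof -
  have gX: "g n -` Y \<inter> space M \<in> events" if "Y \<in> events" for Y n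
    using measurable_sets[OF g(1) that] .
  have prob_gX: "prob (g n -` Y \<inter> space M) = prob Y" if "Y \<in> events" for Y n
    using measure_distr[OF g(1) that, of n] by (simp add: g(2))
  note EgX = sets.Int[OF E(1) gX]
  from gen(1,2) X[unfolded gen(3)] show ?thesis
  proof (induction rule: sigma_sets_induct_disjoint)
    case (basic Y)
    then show ?case by (rule lim)
  next
    case empty
    then show ?case by simp
  next
    case (compl Y)
    then have Y: "Y \<in> events" by (simp add: gen(3))
    have "prob (E n \<inter> (g n -` (space M - Y) \<inter> space M))
        = e - prob (E n \<inter> (g n -` Y \<inter> space M))" for n
    proof -
      have "E n \<inter> (g n -` (space M - Y) \<inter> space M) = E n - E n \<inter> (g n -` Y \<inter> space M)"
        using measurable_space[OF g(1)] sets.sets_into_space[OF E(1)] by blast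
      then show ?thesis
        using finite_measure_Diff[OF E(1) EgX[OF Y]] by (simp add: E(2))
    qed
    moreover have "(\<lambda>n. e - prob (E n \<inter> (g n -` Y \<inter> space M))) \<longlonglongrightarrow> e - e * prob Y"
      by (intro tendsto_intros compl.IH)
    ultimately show ?case by (simp only: prob_compl[OF Y] right_diff_distrib mult_1_right)
  next
    case (union Y)
    then have Y: "Y i \<in> events" for i by (auto simp: gen(3))
    have sums: "(\<lambda>i. prob (Y i)) sums prob (\<Union>i. Y i)"
      using Y union(1) by (intro finite_measure_UNION) auto
    have split: "prob (E n \<inter> (g n -` (\<Union>i. Y i) \<inter> space M))
        = (\<Sum>i. prob (E n \<inter> (g n -` Y i \<inter> space M)))" for n
    proof -
      have "(\<lambda>i. prob (E n \<inter> (g n -` Y i \<inter> space M)))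
          sums prob (\<Union>i. E n \<inter> (g n -` Y i \<inter> space M))"
      proof (rule finite_measure_UNION)
        show "range (\<lambda>i. E n \<inter> (g n -` Y i \<inter> space M)) \<subseteq> events"
          using EgX[OF Y] by blast
        show "disjoint_family (\<lambda>i. E n \<inter> (g n -` Y i \<inter> space M))"
          using union(1) unfolding disjoint_family_on_def by blast
      qed
      moreover have "(\<Union>i. E n \<inter> (g n -` Y i \<inter> space M))
          = E n \<inter> (g n -` (\<Union>i. Y i) \<inter> space M)"
        by blast
      ultimately show ?thesis by (simp add: sums_iff)
    qed
    \<comment> \<open>The \<open>n\<close>-uniform summable bound comes from the invariance of the measure under \<open>g n\<close>.\<close>
    have bound: "norm (prob (E n \<inter> (g n -` Y i \<inter> space M))) \<le> prob (Y i)" for n i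
      using finite_measure_mono[OF Int_lower2 gX[OF Y], of "E n" n i] by (simp add: prob_gX[OF Y])
    have "(\<lambda>n. \<Sum>i. prob (E n \<inter> (g n -` Y i \<inter> space M))) \<longlonglongrightarrow> (\<Sum>i. e * prob (Y i))"
      by (rule tannerys_theorem[where M = "\<lambda>i. prob (Y i)", THEN conjunct2, THEN conjunct2])
        (use union(3) bound sums_summable[OF sums] in \<open>simp_all add: always_eventually\<close>)
    also have "(\<Sum>i. e * prob (Y i)) = e * prob (\<Union>i. Y i)"
      using sums_mult[OF sums] by (rule sums_unique[symmetric])
    finally show ?case by (simp only: split)
  qed
qed

text \<open>
  Mixing of an i.i.d. field \<open>(\<omega>\<^sub>i)\<close> under relabellings \<open>f n\<close> of the index set that eventually
  move every finite set of indices off any given finite set.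
\<close>
theorem iid_field_mixing:
  fixes \<mu> :: "'a measure" and f :: "nat \<Rightarrow> 'i \<Rightarrow> 'i"
  defines "P \<equiv> (\<Pi>\<^sub>M i\<in>UNIV. \<mu>)"
  assumes \<mu>: "prob_space \<mu>"
    and inj: "\<And>n. inj (f n)"
    and disjoint: "\<And>J K. finite J \<Longrightarrow> finite K \<Longrightarrow> \<forall>\<^sub>F n in sequentially. J \<inter> f n ` K = {}"
    and A: "A \<in> sets P" and D: "D \<in> sets P"
  shows "(\<lambda>n. measure P (A \<inter> ((\<lambda>\<omega>. \<omega> \<circ> f n) -` D \<inter> space P))) \<longlonglongrightarrow> measure P A * measure P D"
proof -
  interpret \<mu>: prob_space \<mu> by (rule \<mu>)
  interpret P: prob_space P
    unfolding P_def by (intro prob_space_PiM \<mu>)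
  define G where "G = prod_algebra (UNIV :: 'i set) (\<lambda>_. \<mu>)"
  have space_P: "space P = (\<Pi>\<^sub>E i\<in>UNIV. space \<mu>)"
    by (simp add: P_def space_PiM)
  have gen: "Int_stable G" "G \<subseteq> Pow (space P)" "sets P = sigma_sets (space P) G"
    using prod_algebra_sets_into_space[of UNIV "\<lambda>_. \<mu>"]
    by (auto simp: G_def Int_stable_prod_algebra P_def space_PiM sets_PiM)
  have G_sets: "X \<in> sets P" if "X \<in> G" for X
    using that by (simp add: gen(3) sigma_sets.Basic)
  have meas: "(\<lambda>\<omega>. \<omega> \<circ> f n) \<in> measurable P P" for n
    unfolding P_def comp_def
    by (rule measurable_PiM_single') (auto simp: space_PiM)
  have pres: "distr P P (\<lambda>\<omega>. \<omega> \<circ> f n) = P" for n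
    using distr_PiM_reindex[of UNIV "\<lambda>_. \<mu>" "f n" UNIV] \<mu> inj[of n]
    by (simp add: P_def comp_def restrict_UNIV)
  have pres_id: "distr P P (\<lambda>\<omega>. \<omega>) = P"
    by (rule distr_id)

  define cyl where
    "cyl J S = {\<omega> \<in> space P. \<forall>j\<in>J. \<omega> j \<in> S j}" for J :: "'i set" and S :: "'i \<Rightarrow> 'a set"
  have G_cyl: "\<exists>J S. finite J \<and> (\<forall>j. S j \<in> sets \<mu>) \<and> X = cyl J S" if X: "X \<in> G" for X
  proof -
    obtain J S where JS: "finite J" "S \<in> (\<Pi> j\<in>J. sets \<mu>)"
        "X = prod_emb UNIV (\<lambda>_. \<mu>) J (\<Pi>\<^sub>E j\<in>J. S j)"
      using X unfolding G_def by (rule prod_algebraE) auto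
    \<comment> \<open>The value outside \<open>J\<close> is irrelevant; it only makes all \<open>S' j\<close> measurable.\<close>
    define S' where "S' j = (if j \<in> J then S j else {})" for j
    have "X = cyl J S'"
      unfolding JS(3) by (auto simp: prod_emb_def cyl_def S'_def space_P PiE_iff)
    moreover have "S' j \<in> sets \<mu>" for j using JS(2) by (auto simp: S'_def)
    ultimately show ?thesis using JS(1) by blast
  qed
  have prob_cyl: "P.prob (cyl J S) = (\<Prod>j\<in>J. measure \<mu> (S j))"
    if "finite J" "\<And>j. S j \<in> sets \<mu>" for J S
  proof -
    interpret prod: product_prob_space "\<lambda>_. \<mu>" "UNIV :: 'i set"
      by unfold_locales
    have "P.prob (prod_emb UNIV (\<lambda>_. \<mu>) J (\<Pi>\<^sub>E j\<in>J. S j)) = (\<Prod>j\<in>J. measure \<mu> (S j))"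
      unfolding P_def using that by (intro prod.measure_PiM_emb) auto
    moreover have "prod_emb UNIV (\<lambda>_. \<mu>) J (\<Pi>\<^sub>E j\<in>J. S j) = cyl J S"
      by (auto simp: prod_emb_def cyl_def space_P PiE_iff)
    ultimately show ?thesis by simp
  qed

  have cylinders: "(\<lambda>n. P.prob (X \<inter> ((\<lambda>\<omega>. \<omega> \<circ> f n) -` Y \<inter> space P))) \<longlonglongrightarrow> P.prob X * P.prob Y"
    if "X \<in> G" "Y \<in> G" for X Y
  proof -
    obtain J S where J: "finite J" "\<And>j. S j \<in> sets \<mu>" "X = cyl J S"
      using G_cyl[OF \<open>X \<in> G\<close>] by blast
    obtain K R where K: "finite K" "\<And>j. R j \<in> sets \<mu>" "Y = cyl K R"
      using G_cyl[OF \<open>Y \<in> G\<close>] by blast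
    have "\<forall>\<^sub>F n in sequentially.
        P.prob (X \<inter> ((\<lambda>\<omega>. \<omega> \<circ> f n) -` Y \<inter> space P)) = P.prob X * P.prob Y"
      using disjoint[OF J(1) K(1)]
    proof eventually_elim
      case (elim n)
      \<comment> \<open>The two constraints merge into one cylinder, over the disjoint union of \<open>J\<close> and \<open>f n ` K\<close>.\<close>
      define Q where "Q i = (if i \<in> J then S i else R (inv (f n) i))" for i
      have Qf: "Q (f n k) = R k" if "k \<in> K" for k
        using elim that inj[of n] by (auto simp: Q_def)
      have QJ: "Q j = S j" if "j \<in> J" for j
        using that by (simp add: Q_def)
      have "X \<inter> ((\<lambda>\<omega>. \<omega> \<circ> f n) -` Y \<inter> space P) = cyl (J \<union> f n ` K) Q"
        unfolding J(3) K(3) using measurable_space[OF meas[of n]]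
        by (auto simp: cyl_def QJ Qf ball_Un)
      moreover have "P.prob (cyl (J \<union> f n ` K) Q) = (\<Prod>i\<in>J \<union> f n ` K. measure \<mu> (Q i))"
        using J K by (intro prob_cyl) (auto simp: Q_def)
      moreover have "\<dots> = (\<Prod>i\<in>J. measure \<mu> (Q i)) * (\<Prod>i\<in>f n ` K. measure \<mu> (Q i))"
        using J(1) K(1) elim by (intro prod.union_disjoint) auto
      moreover have "(\<Prod>i\<in>J. measure \<mu> (Q i)) = P.prob X"
        using prob_cyl[OF J(1,2)] by (simp add: J(3) Q_def)
      moreover have "(\<Prod>i\<in>f n ` K. measure \<mu> (Q i)) = P.prob Y"
        using prob_cyl[OF K(1,2)] inj_on_subset[OF inj[of n] subset_UNIV]
        by (simp add: K(3) prod.reindex Qf)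
      ultimately show ?case by simp
    qed
    then show ?thesis by (rule tendsto_eventually)
  qed

  have cylinder_event:
    "(\<lambda>n. P.prob (X \<inter> ((\<lambda>\<omega>. \<omega> \<circ> f n) -` D \<inter> space P))) \<longlonglongrightarrow> P.prob X * P.prob D"
    if "X \<in> G" for X
    by (rule P.tendsto_product_on_generator[where E = "\<lambda>_. X", OF _ _ meas pres gen])
      (use that cylinders G_sets D in auto)
  have prob_D: "P.prob ((\<lambda>\<omega>. \<omega> \<circ> f n) -` D \<inter> space P) = P.prob D" for n
    using measure_distr[OF meas D, of n] by (simp add: pres)
  have "(\<lambda>n. P.prob (((\<lambda>\<omega>. \<omega> \<circ> f n) -` D \<inter> space P) \<inter> ((\<lambda>\<omega>. \<omega>) -` A \<inter> space P)))
      \<longlonglongrightarrow> P.prob D * P.prob A"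
  proof (rule P.tendsto_product_on_generator[OF _ prob_D measurable_ident_sets[OF refl] pres_id gen _ A])
    show "(\<lambda>\<omega>. \<omega> \<circ> f n) -` D \<inter> space P \<in> sets P" for n
      using measurable_sets[OF meas D] .
    fix X assume X: "X \<in> G"
    have "((\<lambda>\<omega>. \<omega> \<circ> f n) -` D \<inter> space P) \<inter> ((\<lambda>\<omega>. \<omega>) -` X \<inter> space P)
        = X \<inter> ((\<lambda>\<omega>. \<omega> \<circ> f n) -` D \<inter> space P)" for n
      using X gen(2) by auto
    then show "(\<lambda>n. P.prob (((\<lambda>\<omega>. \<omega> \<circ> f n) -` D \<inter> space P) \<inter> ((\<lambda>\<omega>. \<omega>) -` X \<inter> space P)))
        \<longlonglongrightarrow> P.prob D * P.prob X"
      using cylinder_event[OF X] by (simp add: mult.commute)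
  qed
  moreover have "((\<lambda>\<omega>. \<omega> \<circ> f n) -` D \<inter> space P) \<inter> ((\<lambda>\<omega>. \<omega>) -` A \<inter> space P)
      = A \<inter> ((\<lambda>\<omega>. \<omega> \<circ> f n) -` D \<inter> space P)" for n
    using sets.sets_into_space[OF A] by auto
  ultimately show ?thesis by (simp add: mult.commute)
qed

lemma inv_env_shift: "inv (env_shift z) = env_shift (- z)"
  by (rule inv_equality) (auto simp: env_shift_def)

lemma inv_env_shift_funpow:
  "(inv (env_shift z) ^^ n) \<omega> = \<omega> \<circ> (\<lambda>x. (fst x - int n * fst z, snd x - int n * snd z))"
proof (induction n)
  case (Suc n)
  then show ?case
    by (simp only: funpow.simps comp_apply inv_env_shift)
      (auto simp: env_shift_def fun_eq_iff algebra_simps)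
qed (simp add: comp_def)

lemma eventually_disjoint_translate:
  fixes z :: site
  assumes z: "z \<noteq> 0" and J: "finite J" and L: "finite L"
  shows "\<forall>\<^sub>F n in sequentially. J \<inter> (\<lambda>x. (fst x - int n * fst z, snd x - int n * snd z)) ` L = {}"
proof -
  have "\<forall>\<^sub>F n in sequentially. j \<noteq> (fst k - int n * fst z, snd k - int n * snd z)"
    for j k :: site
  proof -
    \<comment> \<open>As \<open>z \<noteq> 0\<close>, at most one multiple of \<open>z\<close> equals \<open>k - j\<close>.\<close>
    have "finite {n. j = (fst k - int n * fst z, snd k - int n * snd z)}"
    proof (rule finite_subset)
      show "{n. j = (fst k - int n * fst z, snd k - int n * snd z)}
          \<subseteq> {THE n. j = (fst k - int n * fst z, snd k - int n * snd z)}"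
        using z by (auto simp: prod_eq_iff intro!: the_equality[symmetric])
    qed simp
    then show ?thesis
      by (simp add: cofinite_eq_sequentially[symmetric] eventually_cofinite)
  qed
  then have "\<forall>\<^sub>F n in sequentially. \<forall>j\<in>J. \<forall>k\<in>L.
      j \<noteq> (fst k - int n * fst z, snd k - int n * snd z)"
    using J L by (simp add: eventually_ball_finite_distrib)
  then show ?thesis by eventually_elim blast
qed

lemma jointly_measurableD:
  assumes "jointly_measurable P b"
  shows "(\<lambda>\<omega>. b \<omega> x y) \<in> borel_measurable P"
proof -
  have "(\<lambda>\<omega>. (\<omega>, x, y)) \<in> measurable P (P \<Otimes>\<^sub>M (count_space UNIV \<Otimes>\<^sub>M count_space UNIV))"
    by measurable
  from measurable_compose[OF this assms[unfolded jointly_measurable_def]] show ?thesis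
    by simp
qed

lemma measurable_state_of:
  assumes "busemann_process P B"
  shows "state_of P B \<in> measurable P (state_space P)"
proof -
  have "(\<lambda>\<omega>. case i of (x, y, h, s) \<Rightarrow> B h s \<omega> x y) \<in> borel_measurable P"
    if "i \<in> state_index P" for i
    using that assms
    by (cases i) (auto simp: state_index_def busemann_process_def intro!: jointly_measurableD)
  then show ?thesis
    unfolding state_of_def state_space_def by (rule measurable_restrict)
qed

theorem corollary3p13:
  fixes \<mu> :: "real measure"
    and P :: "env measure"
    and \<epsilon> :: real
    and B :: "tilt \<Rightarrow> side \<Rightarrow> env \<Rightarrow> site \<Rightarrow> site \<Rightarrow> real"
    and z :: site
    and A :: "env set"
    and C :: "(site \<times> site \<times> tilt \<times> side \<Rightarrow> real) set"
  assumes "prob_space \<mu>" and "sets \<mu> = sets borel"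
    and "P = (\<Pi>\<^sub>M x\<in>UNIV. \<mu>)"
    and "\<epsilon> > 0" and "integrable P (\<lambda>\<omega>. \<bar>\<omega> 0\<bar> powr (2 + \<epsilon>))"
    and "(\<integral>\<omega>. (\<omega> 0)\<^sup>2 \<partial>P) > (\<integral>\<omega>. \<omega> 0 \<partial>P)\<^sup>2"
    and "busemann_process P B"
    and "z \<noteq> 0"
    and "A \<in> sets P"
    and "C \<in> sets (state_space P)"
  shows "(\<lambda>n. measure P {\<omega> \<in> space P. \<omega> \<in> A \<and> state_of P B ((inv (env_shift z) ^^ n) \<omega>) \<in> C})
           \<longlonglongrightarrow> measure P A * measure P {\<omega> \<in> space P. state_of P B \<omega> \<in> C}"
proof -
  define f where "f n x = (fst x - int n * fst z, snd x - int n * snd z)" for n and x :: site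
  define D where "D = state_of P B -` C \<inter> space P"
  have space_P: "space P = UNIV"
    using sets_eq_imp_space_eq[OF assms(2)] by (simp add: assms(3) space_PiM)
  have D: "D \<in> sets P"
    unfolding D_def using measurable_sets[OF measurable_state_of[OF assms(7)] assms(10)] .
  have "(\<lambda>n. measure P (A \<inter> ((\<lambda>\<omega>. \<omega> \<circ> f n) -` D \<inter> space P))) \<longlonglongrightarrow> measure P A * measure P D"
    unfolding assms(3)
  proof (rule iid_field_mixing)
    show "inj (f n)" for n
      by (auto simp: inj_on_def f_def prod_eq_iff)
    show "\<forall>\<^sub>F n in sequentially. J \<inter> f n ` K = {}" if "finite J" "finite K" for J K
      using eventually_disjoint_translate[OF assms(8) that] by (simp add: f_def[abs_def])
  qed (use assms(1,9) D in \<open>simp_all add: assms(3)\<close>)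
  moreover have "(inv (env_shift z) ^^ n) \<omega> = \<omega> \<circ> f n" for n \<omega>
    by (simp add: inv_env_shift_funpow f_def[abs_def])
  then have "{\<omega> \<in> space P. \<omega> \<in> A \<and> state_of P B ((inv (env_shift z) ^^ n) \<omega>) \<in> C}
      = A \<inter> ((\<lambda>\<omega>. \<omega> \<circ> f n) -` D \<inter> space P)" for n
    by (auto simp: D_def space_P)
  moreover have "{\<omega> \<in> space P. state_of P B \<omega> \<in> C} = D"
    by (auto simp: D_def)
  ultimately show ?thesis by simp
qed

end
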